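(* Let $\mathcal{F}\subseteq\mathcal{P}(W)$ be a countably infinite opinion set over a set $W$ of worlds (of arbitrary cardinality), let $\mathscr{I}$ be a generalized legitimate inaccuracy measure, and let $c$ be an incoherent credence function on $\mathcal{F}$. Then: (1) $c$ is weakly dominated relative to $\mathscr{I}$ by a coherent credence function on $\mathcal{F}$; and (2) if $\mathscr{I}(c,w)<\infty$ for each $w\in W$, then $c$ is strongly dominated relative to $\mathscr{I}$ by a coherent credence function on $\mathcal{F}$.
   Context: $W$ is a nonempty set (of worlds). An opinion set is a set $\mathcal{F}\subseteq\mathcal{P}(W)$. A credence function on $\mathcal{F}$ is any function $c:\mathcal{F}\to[0,1]$. An algebra over $W$ is a subset of $\mathcal{P}(W)$ containing $W$ and closed under binary unions and complements. A credence function $c$ is coherent if there are an algebra $\mathcal{F}'\supseteq\mathcal{F}$ over $W$ and a function $c':\mathcal{F}'\to[0,1]$ extending $c$ with $c'(W)=1$ and $c'(p\cup q)=c'(p)+c'(q)$ for disjoint $p,q\in\mathcal{F}'$; otherwise $c$ is incoherent. For $w\in W$, $v_w:\mathcal{F}\to\{0,1\}$ is given by $v_w(p)=1$ iff $w\in p$. A bounded one-dimensional Bregman divergence is a bounded function $\mathfrak{d}:[0,1]^2\to[0,\infty)$ of the form $\mathfrak{d}(x,y)=\varphi(x)-\varphi(y)-\varphi'(y)(x-y)$, where $\varphi:[0,1]\to\mathbb{R}$ is continuous and strictly convex on $[0,1]$, continuously differentiable on $(0,1)$, and $\varphi'(i):=\lim_{x\to i}\varphi'(x)$ for $i\in\{0,1\}$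 (boundedness of $\mathfrak{d}$ is equivalent to these limits being finite). For a countably infinite opinion set $\mathcal{F}$ with enumeration $\mathcal{F}=\{p_1,p_2,\ldots\}$ (without repetition), a generalized legitimate inaccuracy measure is a map $\mathscr{I}$ assigning to each credence function $c$ on $\mathcal{F}$ and $w\in W$ the value $\mathscr{I}(c,w)=\sum_{i=1}^\infty a_i\,\mathfrak{d}(v_w(p_i),c(p_i))\in[0,\infty]$, where $\mathfrak{d}$ is a bounded one-dimensional Bregman divergence and $a_i\in(0,\infty)$ with $\sup_i a_i<\infty$. A credence function $d$ weakly dominates $c$ relative to $\mathscr{I}$ if $\mathscr{I}(c,w)\ge\mathscr{I}(d,w)$ for all $w\in W$ and $\mathscr{I}(c,w)>\mathscr{I}(d,w)$ for some $w\in W$; $d$ strongly dominates $c$ if $\mathscr{I}(c,w)>\mathscr{I}(d,w)$ for all $w\in W$. *)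

theory Defs
  imports "HOL-Analysis.Analysis"
begin

text \<open>
  A credence function on \<open>F\<close> is modelled by a total function on sets of worlds; only its values
  on \<open>F\<close> are constrained, and all notions below depend only on those values.
\<close>

definition credence :: "'w set set \<Rightarrow> ('w set \<Rightarrow> real) \<Rightarrow> bool" where
  "credence F c \<longleftrightarrow> c \<in> F \<rightarrow> {0..1}"

definition coherent :: "'w set \<Rightarrow> 'w set set \<Rightarrow> ('w set \<Rightarrow> real) \<Rightarrow> bool" where
  "coherent W F c \<longleftrightarrow> credence F c \<and>
     (\<exists>F' c'. algebra W F' \<and> F \<subseteq> F' \<and> credence F' c' \<and> (\<forall>p\<in>F. c' p = c p) \<and>
        c' W = 1 \<and> additive F' c')"

definition incoherent :: "'w set \<Rightarrow> 'w set set \<Rightarrow> ('w set \<Rightarrow> real) \<Rightarrow> bool" where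
  "incoherent W F c \<longleftrightarrow> credence F c \<and> \<not> coherent W F c"

definition strictly_convex_on :: "real set \<Rightarrow> (real \<Rightarrow> real) \<Rightarrow> bool" where
  "strictly_convex_on S f \<longleftrightarrow> convex S \<and>
     (\<forall>x\<in>S. \<forall>y\<in>S. \<forall>t. x \<noteq> y \<and> 0 < t \<and> t < 1 \<longrightarrow>
        f ((1 - t) * x + t * y) < (1 - t) * f x + t * f y)"

text \<open>
  The function \<open>\<phi>'\<close> is the derivative of \<open>\<phi>\<close> on the open interval, extended to the end points by
  its limits there. These limits are real numbers, i.e. finite.
\<close>

definition bounded_bregman :: "(real \<Rightarrow> real \<Rightarrow> real) \<Rightarrow> bool" where
  "bounded_bregman \<dd> \<longleftrightarrow>
     (\<forall>x\<in>{0..1}. \<forall>y\<in>{0..1}. 0 \<le> \<dd> x y) \<and>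
     bounded ((\<lambda>(x, y). \<dd> x y) ` ({0..1} \<times> {0..1})) \<and>
     (\<exists>\<phi> \<phi>'.
        continuous_on {0..1} \<phi> \<and> strictly_convex_on {0..1} \<phi> \<and>
        (\<forall>x\<in>{0<..<1}. (\<phi> has_real_derivative \<phi>' x) (at x)) \<and>
        continuous_on {0<..<1} \<phi>' \<and>
        (\<phi>' \<longlongrightarrow> \<phi>' 0) (at_right 0) \<and> (\<phi>' \<longlongrightarrow> \<phi>' 1) (at_left 1) \<and>
        (\<forall>x\<in>{0..1}. \<forall>y\<in>{0..1}. \<dd> x y = \<phi> x - \<phi> y - \<phi>' y * (x - y)))"

definition truth_value :: "'w \<Rightarrow> 'w set \<Rightarrow> real" where
  "truth_value w p = (if w \<in> p then 1 else 0)"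

text \<open>
  The enumeration \<open>p\<close> starts at index \<open>0\<close>. All summands are nonnegative, so \<^const>\<open>ennreal\<close> does not
  truncate, and the sum always exists in \<^typ>\<open>ennreal\<close>.
\<close>

definition gen_legitimate_inaccuracy ::
    "'w set \<Rightarrow> 'w set set \<Rightarrow> (('w set \<Rightarrow> real) \<Rightarrow> 'w \<Rightarrow> ennreal) \<Rightarrow> bool" where
  "gen_legitimate_inaccuracy W F \<I> \<longleftrightarrow>
     (\<exists>p \<dd> a. bij_betw p (UNIV :: nat set) F \<and> bounded_bregman \<dd> \<and>
        (\<forall>i. (0::real) < a i) \<and> bdd_above (range a) \<and>
        (\<forall>c w. credence F c \<and> w \<in> W \<longrightarrow>
           \<I> c w = (\<Sum>i. ennreal (a i * \<dd> (truth_value w (p i)) (c (p i))))))"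

definition weakly_dominates ::
    "'w set \<Rightarrow> (('w set \<Rightarrow> real) \<Rightarrow> 'w \<Rightarrow> ennreal) \<Rightarrow> ('w set \<Rightarrow> real) \<Rightarrow> ('w set \<Rightarrow> real) \<Rightarrow> bool" where
  "weakly_dominates W \<I> d c \<longleftrightarrow> (\<forall>w\<in>W. \<I> c w \<ge> \<I> d w) \<and> (\<exists>w\<in>W. \<I> c w > \<I> d w)"

definition strongly_dominates ::
    "'w set \<Rightarrow> (('w set \<Rightarrow> real) \<Rightarrow> 'w \<Rightarrow> ennreal) \<Rightarrow> ('w set \<Rightarrow> real) \<Rightarrow> ('w set \<Rightarrow> real) \<Rightarrow> bool" where
  "strongly_dominates W \<I> d c \<longleftrightarrow> (\<forall>w\<in>W. \<I> c w > \<I> d w)"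

end

theory Submission
  imports Defs
begin

text \<open>
  The coherent credence functions are the restrictions of finitely additive probabilities on
  \<^term>\<open>Pow W\<close>, which form a convex compact set in the product topology. If \<open>c\<close> has finite
  inaccuracy somewhere, then the lower semicontinuous function \<open>D(\<cdot>, c)\<close>, with
  \<open>D(x, y) = (\<Sum>i. a\<^sub>i * \<dd> (x p\<^sub>i) (y p\<^sub>i))\<close>, attains a finite minimum over this set, at \<open>\<pi>\<close> say,
  and this minimum is positive when \<open>c\<close> is incoherent. The Pythagorean inequality
  \<open>D(z, c) \<ge> D(\<pi>, c) + D(z, \<pi>)\<close>, applied to the point masses \<open>z\<close>, shows that \<open>\<pi>\<close> is strictly more
  accurate than \<open>c\<close> in every world where \<open>c\<close> has finite inaccuracy. If \<open>c\<close> has infinite inaccuracy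
  everywhere, any point mass weakly dominates it.
\<close>

section \<open>Bregman divergences\<close>

lemma bounded_bregman_nonneg:
  assumes "bounded_bregman \<dd>" "x \<in> {0..1}" "y \<in> {0..1}"
  shows "0 \<le> \<dd> x y"
  using assms by (auto simp: bounded_bregman_def)

lemma bounded_bregman_self:
  assumes "bounded_bregman \<dd>" "x \<in> {0..1}"
  shows "\<dd> x x = 0"
  using assms by (auto simp: bounded_bregman_def)

lemma unit_interval_combination:
  fixes x y t :: real
  assumes "x \<in> {0..1}" "y \<in> {0..1}" "t \<in> {0..1}"
  shows "(1 - t) * x + t * y \<in> {0..1}"
  using convexD_alt[of "{0..1::real}" x y t] assms by simp

text \<open>In its first argument \<open>\<dd>\<close> is \<open>\<phi>\<close> plus an affine
  function, so the convexity gap of \<open>\<dd>\<close> at the mean \<open>u\<close> is that of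
  \<open>\<phi>\<close>, whatever the second argument. The identity compares the gaps for the second
  arguments \<open>y\<close> and \<open>u\<close>; for the latter the value at \<open>u\<close>
  itself vanishes.\<close>

lemma bounded_bregman_compensation:
  assumes "bounded_bregman \<dd>" "x \<in> {0..1}" "z \<in> {0..1}" "y \<in> {0..1}" "t \<in> {0..1}"
  defines "u \<equiv> (1 - t) * x + t * z"
  shows "(1 - t) * \<dd> x y + t * \<dd> z y = \<dd> u y + (1 - t) * \<dd> x u + t * \<dd> z u"
proof -
  obtain \<phi> \<phi>' where d: "\<forall>x\<in>{0..1}. \<forall>y\<in>{0..1}. \<dd> x y = \<phi> x - \<phi> y - \<phi>' y * (x - y)"
    using assms(1) unfolding bounded_bregman_def by blast
  have "u \<in> {0..1}"
    unfolding u_def by (intro unit_interval_combination assms)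
  then have eqs: "\<dd> x y = \<phi> x - \<phi> y - \<phi>' y * (x - y)" "\<dd> z y = \<phi> z - \<phi> y - \<phi>' y * (z - y)"
    "\<dd> u y = \<phi> u - \<phi> y - \<phi>' y * (u - y)" "\<dd> x u = \<phi> x - \<phi> u - \<phi>' u * (x - u)"
    "\<dd> z u = \<phi> z - \<phi> u - \<phi>' u * (z - u)"
    using d assms(2-4) by auto
  have "(1 - t) * (x - u) + t * (z - u) = 0" "u - y = (1 - t) * (x - y) + t * (z - y)"
    unfolding u_def by (simp_all add: algebra_simps)
  then have "\<phi>' u * ((1 - t) * (x - u) + t * (z - u)) = 0"
    "\<phi>' y * (u - y) = \<phi>' y * ((1 - t) * (x - y) + t * (z - y))"
    by simp_all
  then show ?thesis
    unfolding eqs by (simp only: algebra_simps)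
qed

text \<open>With \<open>y\<close> fixed, \<open>\<dd>\<close> is strictly convex in its first
  argument and vanishes at \<open>y\<close>. Hence its value at the midpoint \<open>m\<close>, which
  is nonnegative, lies strictly below half its value at \<open>x\<close>.\<close>

lemma bounded_bregman_pos:
  assumes "bounded_bregman \<dd>" "x \<in> {0..1}" "y \<in> {0..1}" "x \<noteq> y"
  shows "0 < \<dd> x y"
proof -
  obtain \<phi> \<phi>' where sc: "strictly_convex_on {0..1} \<phi>"
    and d: "\<forall>x\<in>{0..1}. \<forall>y\<in>{0..1}. \<dd> x y = \<phi> x - \<phi> y - \<phi>' y * (x - y)"
    using assms(1) unfolding bounded_bregman_def by blast
  define m where "m = (1 - 1/2) * x + (1/2) * y"
  have m: "m \<in> {0..1}"
    unfolding m_def by (rule unit_interval_combination) (use assms in auto)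
  have "\<phi> m < (1 - 1/2) * \<phi> x + (1/2) * \<phi> y"
    using sc[unfolded strictly_convex_on_def, THEN conjunct2, rule_format, of x y "1/2"] assms(2-4)
    unfolding m_def by simp
  moreover have "0 \<le> \<phi> m - \<phi> y - \<phi>' y * (m - y)"
    using bounded_bregman_nonneg[OF assms(1) m assms(3)] d[rule_format, OF m assms(3)] by simp
  moreover have "\<phi>' y * (m - y) = \<phi>' y * (x - y) / 2"
    unfolding m_def by (simp add: field_simps)
  ultimately have "0 < (\<phi> x - \<phi> y - \<phi>' y * (x - y)) / 2"
    by (simp add: field_simps)
  then show ?thesis
    unfolding d[rule_format, OF assms(2,3)] by simp
qed

lemma bounded_bregman_continuous_left:
  assumes "bounded_bregman \<dd>" "y \<in> {0..1}"
  shows "continuous_on {0..1} (\<lambda>x. \<dd> x y)"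
proof -
  obtain \<phi> \<phi>' where \<phi>: "continuous_on {0..1} \<phi>"
    and d: "\<forall>x\<in>{0..1}. \<forall>y\<in>{0..1}. \<dd> x y = \<phi> x - \<phi> y - \<phi>' y * (x - y)"
    using assms(1) unfolding bounded_bregman_def by blast
  have "continuous_on {0..1} (\<lambda>x. \<phi> x - \<phi> y - \<phi>' y * (x - y))"
    by (intro continuous_intros \<phi>)
  then show ?thesis
    by (rule continuous_on_eq) (use d assms(2) in auto)
qed

text \<open>The finite one-sided limits make \<open>\<phi>'\<close> continuous on the closed
  interval. This later permits a limit in the second argument even when it tends to 0 or 1.\<close>

lemma bounded_bregman_continuous_right:
  assumes "bounded_bregman \<dd>" "x \<in> {0..1}"
  shows "continuous_on {0..1} (\<dd> x)"
proof -
  obtain \<phi> \<phi>' where \<phi>: "continuous_on {0..1} \<phi>" and \<phi>': "continuous_on {0<..<1} \<phi>'"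
    and lims: "(\<phi>' \<longlongrightarrow> \<phi>' 0) (at_right 0)" "(\<phi>' \<longlongrightarrow> \<phi>' 1) (at_left 1)"
    and d: "\<forall>x\<in>{0..1}. \<forall>y\<in>{0..1}. \<dd> x y = \<phi> x - \<phi> y - \<phi>' y * (x - y)"
    using assms(1) unfolding bounded_bregman_def by blast
  have "continuous_on {0..1} \<phi>'"
  proof (rule continuous_on_IccI)
    fix y :: real assume "0 < y" "y < 1"
    then show "\<phi>' \<midarrow>y\<rightarrow> \<phi>' y"
      using \<phi>' by (simp add: continuous_on_eq_continuous_at isCont_def)
  qed (use lims in auto)
  then have "continuous_on {0..1} (\<lambda>y. \<phi> x - \<phi> y - \<phi>' y * (x - y))"
    by (intro continuous_intros \<phi>)
  then show ?thesis
    by (rule continuous_on_eq) (use d assms(2) in auto)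
qed

section \<open>Minimisation and the Pythagorean inequality\<close>

text \<open>The series need not be continuous, but its partial sums are, so the sets
  \<open>A n\<close> on which they stay below the infimum \<open>r\<close> are closed. By
  compactness some point lies in all of them, and there the whole series is at most
  \<open>r\<close>.\<close>

lemma suminf_ennreal_attains_inf:
  fixes f :: "nat \<Rightarrow> 'a::topological_space \<Rightarrow> real"
  assumes "compact M" "closed M" "M \<noteq> {}"
    and cont: "\<And>i. continuous_on M (f i)"
    and nonneg: "\<And>i m. m \<in> M \<Longrightarrow> 0 \<le> f i m"
  shows "\<exists>m\<in>M. \<forall>m'\<in>M. (\<Sum>i. ennreal (f i m)) \<le> (\<Sum>i. ennreal (f i m'))"
proof -
  define r where "r = (INF m\<in>M. \<Sum>i. ennreal (f i m))"
  define A where "A n = {m \<in> M. ennreal (\<Sum>i<n. f i m) \<le> r}" for n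
  have closed: "closed (A n)" for n
  proof -
    have "continuous_on M (\<lambda>m. ennreal (\<Sum>i<n. f i m))"
      by (intro continuous_on_ennreal continuous_intros cont)
    then have "closed ((\<lambda>m. ennreal (\<Sum>i<n. f i m)) -` {..r} \<inter> M)"
      using assms(2) by (simp add: continuous_on_closed_vimage)
    then show ?thesis
      by (rule back_subst[of closed]) (auto simp: A_def)
  qed
  have partial: "ennreal (\<Sum>i<n. f i m) = (\<Sum>i<n. ennreal (f i m))" if "m \<in> M" for n m
    by (rule sum_ennreal[symmetric]) (rule nonneg[OF that])
  \<comment> \<open>A minimiser of the partial sum of length \<open>N\<close> lies in every
    \<open>A n\<close> with \<open>n \<le> N\<close>: shorter partial sums are no larger, and no
    partial sum at a point \<open>m'\<close> exceeds the series there.\<close>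
  have "M \<inter> (\<Inter>n\<in>I. A n) \<noteq> {}" if I: "finite I" for I
  proof -
    obtain N where N: "I \<subseteq> {..N}"
      using finite_nat_iff_bounded_le[of I] I by blast
    have "continuous_on M (\<lambda>m. \<Sum>i<N. f i m)"
      by (intro continuous_on_sum cont)
    then obtain m where m: "m \<in> M" "\<And>m'. m' \<in> M \<Longrightarrow> (\<Sum>i<N. f i m) \<le> (\<Sum>i<N. f i m')"
      using continuous_attains_inf[OF assms(1,3)] by blast
    have "m \<in> A n" if "n \<le> N" for n
    proof -
      have "ennreal (\<Sum>i<n. f i m) \<le> (\<Sum>i. ennreal (f i m'))" if "m' \<in> M" for m'
      proof -
        have "(\<Sum>i<n. f i m) \<le> (\<Sum>i<N. f i m)"
          by (rule sum_mono2) (use \<open>n \<le> N\<close> nonneg[OF m(1)] in auto)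
        also have "\<dots> \<le> (\<Sum>i<N. f i m')"
          by (rule m(2)[OF that])
        finally have "ennreal (\<Sum>i<n. f i m) \<le> (\<Sum>i<N. ennreal (f i m'))"
          unfolding partial[OF that, symmetric] by (rule ennreal_leI)
        also have "\<dots> \<le> (\<Sum>i. ennreal (f i m'))"
          by (rule sum_le_suminf) auto
        finally show ?thesis .
      qed
      then show ?thesis
        unfolding A_def r_def using m(1) by (intro CollectI conjI INF_greatest)
    qed
    then have "m \<in> M \<inter> (\<Inter>n\<in>I. A n)" using m(1) N by blast
    then show ?thesis by blast
  qed
  then have "M \<inter> (\<Inter>n. A n) \<noteq> {}"
    by (rule compact_imp_fip_image[OF assms(1) closed])
  then obtain m where m: "m \<in> M" "\<And>n. m \<in> A n" by blast
  have "(\<Sum>i. ennreal (f i m)) \<le> r"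
  proof (rule suminf_le_const)
    show "(\<Sum>i<n. ennreal (f i m)) \<le> r" for n
      using m(2)[of n] unfolding A_def partial[OF m(1), symmetric] by blast
  qed simp
  moreover have "r \<le> (\<Sum>i. ennreal (f i m'))" if "m' \<in> M" for m'
    unfolding r_def by (rule INF_lower[OF that])
  ultimately show ?thesis
    using m(1) order_trans by blast
qed

text \<open>Summing the compensation identity along the segment from \<open>x\<close> to
  \<open>z\<close> and using minimality of \<open>x\<close> bounds the divergence of
  \<open>z\<close> from the point \<open>u t\<close> by that of \<open>z\<close> from
  \<open>y\<close> minus that of \<open>x\<close> from \<open>y\<close>, after division by
  \<open>t\<close>. Then \<open>t\<close> tends to 0.\<close>

lemma bregman_pythagoras:
  fixes a x z y :: "nat \<Rightarrow> real"
  assumes \<dd>: "bounded_bregman \<dd>" and a: "\<And>i. 0 < a i"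
    and x: "\<And>i. x i \<in> {0..1}" and z: "\<And>i. z i \<in> {0..1}" and y: "\<And>i. y i \<in> {0..1}"
    and fin: "(\<Sum>i. ennreal (a i * \<dd> (z i) (y i))) < \<infinity>"
    and min: "\<And>t. 0 \<le> t \<Longrightarrow> t \<le> 1 \<Longrightarrow> (\<Sum>i. ennreal (a i * \<dd> (x i) (y i)))
                \<le> (\<Sum>i. ennreal (a i * \<dd> ((1 - t) * x i + t * z i) (y i)))"
  shows "(\<Sum>i. ennreal (a i * \<dd> (x i) (y i))) + (\<Sum>i. ennreal (a i * \<dd> (z i) (x i)))
           \<le> (\<Sum>i. ennreal (a i * \<dd> (z i) (y i)))"
proof -
  define X where "X i = a i * \<dd> (x i) (y i)" for i
  define Z where "Z i = a i * \<dd> (z i) (y i)" for i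
  define u where "u t i = (1 - t) * x i + t * z i" for t i
  define U where "U t i = a i * \<dd> (u t i) (y i)" for t i
  define V where "V t i = a i * \<dd> (z i) (u t i)" for t i
  have u: "u t i \<in> {0..1}" if "t \<in> {0..1}" for t i
    unfolding u_def by (rule unit_interval_combination[OF x z that])
  have nn: "0 \<le> a i * \<dd> s s'" if "s \<in> {0..1}" "s' \<in> {0..1}" for i s s'
    using bounded_bregman_nonneg[OF \<dd> that] a[of i] by simp
  have X0: "0 \<le> X i" and Z0: "0 \<le> Z i" for i
    unfolding X_def Z_def by (intro nn x y z)+
  have sZ: "summable Z"
    by (rule summable_suminf_not_top) (use fin Z0 in \<open>auto simp: Z_def\<close>)
  \<comment> \<open>At \<open>t = 1\<close> the segment reaches \<open>z\<close>, so the finite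
    divergence of \<open>z\<close> bounds the minimum.\<close>
  have Xfin: "(\<Sum>i. ennreal (X i)) < \<infinity>"
    using min[of 1] fin unfolding X_def by simp
  have sX: "summable X"
    by (rule summable_suminf_not_top) (use Xfin X0 in auto)
  have sumX: "(\<Sum>i. ennreal (X i)) = ennreal (suminf X)"
    by (rule suminf_ennreal2[OF X0 sX])
  have sumZ: "(\<Sum>i. ennreal (Z i)) = ennreal (suminf Z)"
    by (rule suminf_ennreal2[OF Z0 sZ])
  have V_le: "(\<Sum>i<n. V t i) \<le> suminf Z - suminf X" if t: "0 < t" "t < 1" for t n
  proof -
    have t': "t \<in> {0..1}" using t by auto
    have U0: "0 \<le> U t i" and V0: "0 \<le> V t i" for i
      unfolding U_def V_def using nn u[OF t'] y z by auto
    have le: "U t i + t * V t i \<le> (1 - t) * X i + t * Z i" for i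
    proof -
      have "(1 - t) * X i + t * Z i
          = a i * ((1 - t) * \<dd> (x i) (y i) + t * \<dd> (z i) (y i))"
        unfolding X_def Z_def by (simp add: algebra_simps)
      also have "\<dots> = a i * (\<dd> (u t i) (y i) + (1 - t) * \<dd> (x i) (u t i) + t * \<dd> (z i) (u t i))"
        unfolding u_def using bounded_bregman_compensation[OF \<dd> x z y t'] by simp
      also have "\<dots> = U t i + t * V t i + (1 - t) * (a i * \<dd> (x i) (u t i))"
        unfolding U_def V_def by (simp add: algebra_simps)
      finally show ?thesis
        using nn[OF x u[OF t'], of i i i] t by simp
    qed
    have sXZ: "summable (\<lambda>i. (1 - t) * X i + t * Z i)"
      by (intro summable_add summable_mult sX sZ)
    have sU: "summable (U t)"
    proof (rule summable_comparison_test'[OF sXZ])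
      show "norm (U t i) \<le> (1 - t) * X i + t * Z i" for i
        using le[of i] U0[of i] mult_nonneg_nonneg[OF less_imp_le[OF t(1)] V0[of i]]
        unfolding real_norm_def by linarith
    qed
    have "ennreal (suminf X) \<le> ennreal (suminf (U t))"
      using min[of t] t suminf_ennreal2[OF U0 sU] sumX unfolding X_def U_def u_def by simp
    then have XU: "suminf X \<le> suminf (U t)"
      using suminf_nonneg[OF sU U0] by (simp add: ennreal_le_iff)
    \<comment> \<open>Each term of the right-hand sum is nonnegative by \<open>le\<close>, so the
      finite sum can be enlarged to the full series.\<close>
    have "t * (\<Sum>i<n. V t i) \<le> (\<Sum>i<n. (1 - t) * X i + t * Z i - U t i)"
      unfolding sum_distrib_left by (rule sum_mono) (use le in \<open>simp add: algebra_simps\<close>)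
    also have "\<dots> \<le> (\<Sum>i. (1 - t) * X i + t * Z i - U t i)"
    proof (rule sum_le_suminf)
      show "summable (\<lambda>i. (1 - t) * X i + t * Z i - U t i)"
        by (intro summable_diff sXZ sU)
      show "0 \<le> (1 - t) * X i + t * Z i - U t i" for i
        using le[of i] mult_nonneg_nonneg[OF less_imp_le[OF t(1)] V0[of i]] by linarith
    qed simp
    also have "\<dots> = (1 - t) * suminf X + t * suminf Z - suminf (U t)"
      using sX sZ sU sXZ
      by (simp add: suminf_diff[symmetric] suminf_add[symmetric] suminf_mult summable_mult)
    also have "\<dots> \<le> t * (suminf Z - suminf X)"
      using XU by (simp add: algebra_simps)
    finally show ?thesis using t by simp
  qed
  \<comment> \<open>The bound \<open>V_le\<close> is uniform in \<open>t\<close> and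
    \<open>n\<close>. Taking the limit in finite sums first avoids exchanging it with the
    series.\<close>
  have partial: "(\<Sum>i<n. a i * \<dd> (z i) (x i)) \<le> suminf Z - suminf X" for n
  proof (rule tendsto_upperbound)
    have ev: "eventually (\<lambda>t. t \<in> {0<..<1::real}) (at_right 0)"
      by (rule eventually_at_right_real) simp
    show "eventually (\<lambda>t. (\<Sum>i<n. V t i) \<le> suminf Z - suminf X) (at_right 0)"
      using ev by eventually_elim (use V_le in auto)
    have "((\<lambda>t. \<dd> (z i) (u t i)) \<longlongrightarrow> \<dd> (z i) (x i)) (at_right 0)" for i
    proof (rule continuous_on_tendsto_compose[OF bounded_bregman_continuous_right[OF \<dd> z]])
      have "((\<lambda>t. u t i) \<longlongrightarrow> (1 - 0) * x i + 0 * z i) (at_right 0)"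
        unfolding u_def by (intro tendsto_intros)
      then show "((\<lambda>t. u t i) \<longlongrightarrow> x i) (at_right 0)" by simp
      show "\<forall>\<^sub>F t in at_right 0. u t i \<in> {0..1}"
        using ev by eventually_elim (use u in auto)
    qed (use x in auto)
    then show "((\<lambda>t. \<Sum>i<n. V t i) \<longlongrightarrow> (\<Sum>i<n. a i * \<dd> (z i) (x i))) (at_right 0)"
      unfolding V_def by (intro tendsto_intros)
  qed simp
  \<comment> \<open>The empty partial sum shows that the difference is nonnegative, so
    \<open>ennreal\<close> does not truncate it.\<close>
  have XZ: "suminf X \<le> suminf Z" using partial[of 0] by simp
  have "(\<Sum>i. ennreal (a i * \<dd> (z i) (x i))) \<le> ennreal (suminf Z - suminf X)"
    by (rule suminf_le_const)
       (use partial nn z x in \<open>auto simp: sum_ennreal intro!: ennreal_leI\<close>)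
  then have "ennreal (suminf X) + (\<Sum>i. ennreal (a i * \<dd> (z i) (x i)))
      \<le> ennreal (suminf X) + ennreal (suminf Z - suminf X)"
    by (rule add_left_mono)
  also have "\<dots> = ennreal (suminf Z)"
    using XZ suminf_nonneg[OF sX X0] by (subst ennreal_plus[symmetric]) auto
  finally show ?thesis
    using sumX sumZ unfolding X_def Z_def by simp
qed

section \<open>Finitely additive probabilities\<close>

text \<open>The bound covers all \<open>p\<close>, also those not contained in \<open>W\<close>, so
  that the set lies in a product of compact intervals.\<close>

definition charges :: "'w set \<Rightarrow> ('w set \<Rightarrow> real) set" where
  "charges W = {m. (\<forall>p. m p \<in> {0..1}) \<and> m W = 1 \<and> additive (Pow W) m}"

lemma charges_unit: "m \<in> charges W \<Longrightarrow> m p \<in> {0..1}"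
  by (simp add: charges_def)

lemma truth_value_in_charges: "w \<in> W \<Longrightarrow> truth_value w \<in> charges W"
  by (auto simp: charges_def truth_value_def additive_def)

lemma charges_combination:
  assumes "m \<in> charges W" "m' \<in> charges W" "t \<in> {0..1}"
  shows "(\<lambda>p. (1 - t) * m p + t * m' p) \<in> charges W"
proof -
  have "(1 - t) * m p + t * m' p \<in> {0..1}" for p
    by (intro unit_interval_combination charges_unit assms) (use assms in auto)
  then show ?thesis
    using assms(1,2) by (simp add: charges_def additive_def) (simp add: algebra_simps)
qed

lemma coherent_if_charge:
  assumes "F \<subseteq> Pow W" "m \<in> charges W"
  shows "coherent W F m"
  unfolding coherent_def
proof (intro conjI exI[of _ "Pow W"] exI[of _ m] algebra_Pow)
qed (use assms in \<open>auto simp: charges_def credence_def\<close>)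

lemma coherent_cong:
  assumes "coherent W F d" "\<And>p. p \<in> F \<Longrightarrow> c p = d p"
  shows "coherent W F c"
proof -
  have "credence F c"
    using assms unfolding coherent_def credence_def by (auto simp: Pi_iff)
  moreover obtain F' c' where "algebra W F'" "F \<subseteq> F'" "credence F' c'" "\<forall>p\<in>F. c' p = d p"
    "c' W = 1" "additive F' c'"
    using assms(1) unfolding coherent_def by blast
  ultimately show ?thesis
    unfolding coherent_def using assms(2) by auto
qed

text \<open>Each defining condition is a closed relation between finitely many coordinates, and
  coordinates are continuous in the product topology.\<close>

lemma closed_charges: "closed (charges W)"
proof -
  have eq: "charges W = (\<Inter>p. {m. 0 \<le> m p}) \<inter> (\<Inter>p. {m. m p \<le> 1}) \<inter> {m. m W = 1} \<inter>
      (\<Inter>p\<in>Pow W. \<Inter>q\<in>{q \<in> Pow W. p \<inter> q = {}}. {m. m (p \<union> q) = m p + m q})"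
    by (auto simp: charges_def additive_def)
  show ?thesis
    unfolding eq
    by (intro closed_Int closed_INT ballI closed_Collect_le closed_Collect_eq continuous_intros
        continuous_on_product_coordinates)
qed

text \<open>By Tychonoff the cube is compact, and the charges form a closed subset of it.\<close>

lemma compact_charges: "compact (charges W)"
proof -
  have "compactin (product_topology (\<lambda>_. euclidean) UNIV) (PiE UNIV (\<lambda>_::'a set. {0..1::real}))"
    by (subst compactin_PiE) auto
  then have "compact (PiE UNIV (\<lambda>_::'a set. {0..1::real}))"
    by (simp add: euclidean_product_topology)
  then have "compact (PiE UNIV (\<lambda>_. {0..1}) \<inter> charges W)"
    by (intro compact_Int_closed closed_charges)
  moreover have "PiE UNIV (\<lambda>_. {0..1}) \<inter> charges W = charges W"
    by (auto simp: charges_def)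
  ultimately show ?thesis by simp
qed

section \<open>Domination of incoherent credence functions by coherent ones\<close>

theorem theorem3p4:
  fixes W :: "'w set" and F :: "'w set set"
    and \<I> :: "('w set \<Rightarrow> real) \<Rightarrow> 'w \<Rightarrow> ennreal" and c :: "'w set \<Rightarrow> real"
  assumes "W \<noteq> {}" and "F \<subseteq> Pow W" and "countable F" and "infinite F"
    and "gen_legitimate_inaccuracy W F \<I>"
    and "incoherent W F c"
  shows "(\<exists>d. coherent W F d \<and> weakly_dominates W \<I> d c) \<and>
         ((\<forall>w\<in>W. \<I> c w < \<infinity>) \<longrightarrow> (\<exists>d. coherent W F d \<and> strongly_dominates W \<I> d c))"
proof -
  obtain p \<dd> a where p: "bij_betw p (UNIV :: nat set) F" and \<dd>: "bounded_bregman \<dd>"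
    and a: "\<And>i. (0::real) < a i"
    and \<I>: "\<And>c w. credence F c \<Longrightarrow> w \<in> W \<Longrightarrow>
           \<I> c w = (\<Sum>i. ennreal (a i * \<dd> (truth_value w (p i)) (c (p i))))"
    using assms(5) unfolding gen_legitimate_inaccuracy_def by blast
  have c: "credence F c" "\<not> coherent W F c"
    using assms(6) by (auto simp: incoherent_def)
  have pF: "p i \<in> F" for i
    using p by (auto simp: bij_betw_def)
  have c01: "c (p i) \<in> {0..1}" for i
    using c(1) pF[of i] unfolding credence_def by blast
  have coh: "coherent W F m" if "m \<in> charges W" for m
    by (rule coherent_if_charge[OF assms(2) that])
  have cred: "credence F m" if "m \<in> charges W" for m
    using coh[OF that] by (simp add: coherent_def)
  define D where "D m = (\<Sum>i. ennreal (a i * \<dd> (m (p i)) (c (p i))))" for m :: "'w set \<Rightarrow> real"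
  have \<I>c: "\<I> c w = D (truth_value w)" if "w \<in> W" for w
    unfolding D_def by (rule \<I>[OF c(1) that])
  \<comment> \<open>One \<open>d\<close> serves both claims: the improvement is strict wherever
    \<open>c\<close> has finite inaccuracy, and the weak inequality is trivial elsewhere.\<close>
  have dominated: "\<exists>d. coherent W F d \<and>
      (\<forall>w\<in>W. \<I> d w \<le> \<I> c w \<and> (\<I> c w < \<infinity> \<longrightarrow> \<I> d w < \<I> c w))"
    if fin: "w0 \<in> W" "\<I> c w0 < \<infinity>" for w0
  proof -
    have ne: "charges W \<noteq> {}"
      using truth_value_in_charges[OF fin(1)] by auto
    have cont: "continuous_on (charges W) (\<lambda>m. a i * \<dd> (m (p i)) (c (p i)))" for i
    proof (intro continuous_on_mult_left
        continuous_on_compose2[OF bounded_bregman_continuous_left[OF \<dd> c01]])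
      show "continuous_on (charges W) (\<lambda>m. m (p i))"
        by (rule continuous_on_subset[OF continuous_on_product_coordinates]) simp
    qed (use charges_unit in blast)
    have nn: "0 \<le> a i * \<dd> (m (p i)) (c (p i))" if "m \<in> charges W" for i m
      using bounded_bregman_nonneg[OF \<dd> charges_unit[OF that] c01] a[of i] by simp
    obtain d where d: "d \<in> charges W" and d_min: "\<And>m. m \<in> charges W \<Longrightarrow> D d \<le> D m"
      using suminf_ennreal_attains_inf[where f = "\<lambda>i m. a i * \<dd> (m (p i)) (c (p i))",
          OF compact_charges closed_charges ne] cont nn
      unfolding D_def by blast
    have "\<exists>i. d (p i) \<noteq> c (p i)"
    proof (rule ccontr)
      assume "\<nexists>i. d (p i) \<noteq> c (p i)"
      then have "c q = d q" if "q \<in> F" for q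
        using that p by (force simp: bij_betw_def)
      then show False
        using coherent_cong[OF coh[OF d]] c(2) by blast
    qed
    then obtain i where "d (p i) \<noteq> c (p i)" ..
    then have "0 < ennreal (a i * \<dd> (d (p i)) (c (p i)))"
      using bounded_bregman_pos[OF \<dd> charges_unit[OF d] c01] a[of i] by simp
    also have "\<dots> \<le> D d"
      unfolding D_def using sum_le_suminf[of "\<lambda>i. ennreal (a i * \<dd> (d (p i)) (c (p i)))" "{i}"] by simp
    finally have pos: "0 < D d" .
    have strict: "\<I> d w < \<I> c w" if w: "w \<in> W" "\<I> c w < \<infinity>" for w
    proof -
      note z = truth_value_in_charges[OF w(1)]
      \<comment> \<open>With the point mass at \<open>w\<close> as \<open>z\<close>, the divergences
        of \<open>z\<close> from \<open>d\<close> and from \<open>c\<close> are the inaccuracies of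
        \<open>d\<close> and \<open>c\<close> at \<open>w\<close>. The segment from \<open>d\<close>
        to \<open>z\<close> stays within the charges by convexity.\<close>
      have "D d + \<I> d w \<le> \<I> c w"
        unfolding \<I>[OF cred[OF d] w(1)] \<I>[OF c(1) w(1)] D_def
      proof (rule bregman_pythagoras[OF \<dd> a])
        show "(\<Sum>i. ennreal (a i * \<dd> (truth_value w (p i)) (c (p i)))) < \<infinity>"
          using w \<I>[OF c(1) w(1)] by simp
        fix t :: real assume "0 \<le> t" "t \<le> 1"
        then show "(\<Sum>i. ennreal (a i * \<dd> (d (p i)) (c (p i))))
          \<le> (\<Sum>i. ennreal (a i * \<dd> ((1 - t) * d (p i) + t * truth_value w (p i)) (c (p i))))"
          using d_min[OF charges_combination[OF d z, of t]] unfolding D_def by simp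
      qed (use charges_unit[OF d] charges_unit[OF z] c01 in blast)+
      then have le: "\<I> d w + D d \<le> \<I> c w"
        by (simp add: add.commute)
      \<comment> \<open>Adding the positive \<open>D d\<close> is a strict increase only if
        \<open>\<I> d w\<close> is finite, which is secured first.\<close>
      have "\<I> d w \<le> \<I> d w + D d" by simp
      also note le
      also note w(2)
      finally have "\<I> d w < top" by simp
      then have "\<I> d w + 0 < \<I> d w + D d"
        unfolding ennreal_add_left_cancel_less using pos by simp
      also note le
      finally show ?thesis by simp
    qed
    show ?thesis
    proof (intro exI[of _ d] conjI ballI impI coh[OF d])
      fix w assume "w \<in> W"
      then show "\<I> d w \<le> \<I> c w"
        using strict[of w] by (cases "\<I> c w < \<infinity>") (auto simp: less_top[symmetric])
    qed (use strict in auto)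
  qed
  show ?thesis
  proof (intro conjI impI)
    show "\<exists>d. coherent W F d \<and> weakly_dominates W \<I> d c"
    proof (cases "\<exists>w\<in>W. \<I> c w < \<infinity>")
      case True
      then show ?thesis
        using dominated unfolding weakly_dominates_def by meson
    next
      case False
      then have top: "\<I> c w = \<infinity>" if "w \<in> W" for w
        using that by (auto simp: less_top[symmetric])
      obtain w where w: "w \<in> W" using assms(1) by auto
      note z = truth_value_in_charges[OF w]
      \<comment> \<open>At its own world the point mass has zero divergence in every summand, which
        gives the strict inequality at \<open>w\<close>.\<close>
      have "\<I> (truth_value w) w = 0"
        unfolding \<I>[OF cred[OF z] w] using bounded_bregman_self[OF \<dd> charges_unit[OF z]] by simp
      then have "weakly_dominates W \<I> (truth_value w) c"
        unfolding weakly_dominates_def using top w by (auto intro!: bexI[of _ w])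
      then show ?thesis using coh[OF z] by blast
    qed
    assume "\<forall>w\<in>W. \<I> c w < \<infinity>"
    then show "\<exists>d. coherent W F d \<and> strongly_dominates W \<I> d c"
      using dominated assms(1) unfolding strongly_dominates_def by blast
  qed
qed

end
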